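(* Let $\epsilon, \delta > 0$. If $N_2 \in \mathbb N$ satisfies $$\epsilon N_2 \ge \frac{e}{e-1}\log \delta^{-1},$$ then, for any given $\Theta_N \in \mathbb S_{n_q}^+$, $$\mathrm P\Big\{ {\inf}^{\epsilon}\,\langle \Theta_N, Z_q^2\{\bar x\}\rangle < c^N \Big\} < \delta,$$ where $c^N=\min_{1\le j\le N_2}\langle\Theta_N,Z_q^2\{\bar x^{(j)}\}\rangle$.
   Context: System. Consider solutions $\{x_k\}_{k\ge 0}\subset\mathbb R^n$ of the discrete-time initial value problem $\Pi(x)$: $x_{k+1} = A x_k + \phi(x_k)$, $x_0 = x$, where $A:\mathbb R^n\to\mathbb R^n$ is linear and $\phi:\mathbb R^n\to\mathbb R^n$ is Lipschitz continuous with $\phi(0)=0$, and the origin is locally asymptotically stable. For $p\in\mathbb N$, $V_p(x) = \sum_{k=0}^p \|x_k\|_2^2$, where $\{x_k\}$ solves $\Pi(x)$. Fix $\tilde p\in\mathbb N$ and $\tilde r>0$ such that every trajectory with $0<\|x_0\|_2<\tilde r$ satisfies $\|x_j\|_2<\|x_0\|_2$ for all $j\in\{\tilde p,\dots,2\tilde p-1\}$. Fix $p\ge\tilde p$, put $c_p=(p+1)\tilde r^2$ and $\mathcal R_p=\{x\in\mathbb R^n \mid V_p(x)<c_p\}$. Let $\mathcal D\subset\mathbb R^n$ be compact with $\mathcal R_p\subsetneq\mathcal D$. Let $\bar x$ be a random variable with values in $\mathcal D\setminus\mathcal R_p$ and $(\bar x^{(j)})_{j=1}^{N_2}$ independent samples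 with the distribution of $\bar x$. Let $q\in\mathbb N$; $Z_q\{y\}\in\mathbb R^{n_q}$ is the vector of all monomials of $y\in\mathbb R^n$ of degree at most $q$, and $\langle\Theta,Z_q^2\{y\}\rangle = Z_q\{y\}^{\mathrm T}\Theta Z_q\{y\}$ for symmetric $\Theta\in\mathbb R^{n_q\times n_q}$; $\mathbb S_{n_q}^+$ is the set of symmetric positive semidefinite $n_q\times n_q$ matrices. For a real random variable $f(z)$, the probabilistic infimum ${\inf}^\epsilon f(z)$ is the largest number $\gamma$ with $\mathrm P\{f(z)\ge\gamma\}\ge1-\epsilon$. In the claim, $\Theta_N$ is fixed (in the paper it is computed from samples independent of the $\bar x^{(j)}$), ${\inf}^\epsilon$ is with respect to the distribution of $\bar x$, and the outer probability is over the samples $\bar x^{(j)}$. $\log$ is the natural logarithm and $e$ its base. *)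

theory Defs
  imports "HOL-Probability.Probability"
begin

primrec traj :: "(real^'n \<Rightarrow> real^'n) \<Rightarrow> (real^'n \<Rightarrow> real^'n) \<Rightarrow> real^'n \<Rightarrow> nat \<Rightarrow> real^'n" where
  "traj A \<phi> x 0 = x"
| "traj A \<phi> x (Suc k) = A (traj A \<phi> x k) + \<phi> (traj A \<phi> x k)"

definition origin_loc_asymp_stable :: "(real^'n \<Rightarrow> real^'n) \<Rightarrow> (real^'n \<Rightarrow> real^'n) \<Rightarrow> bool" where
  "origin_loc_asymp_stable A \<phi> \<longleftrightarrow>
     (\<forall>\<epsilon>>0. \<exists>\<eta>>0. \<forall>x. norm x < \<eta> \<longrightarrow> (\<forall>k. norm (traj A \<phi> x k) < \<epsilon>)) \<and>
     (\<exists>\<eta>>0. \<forall>x. norm x < \<eta> \<longrightarrow> traj A \<phi> x \<longlonglongrightarrow> 0)"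

definition V :: "(real^'n \<Rightarrow> real^'n) \<Rightarrow> (real^'n \<Rightarrow> real^'n) \<Rightarrow> nat \<Rightarrow> real^'n \<Rightarrow> real" where
  "V A \<phi> p x = (\<Sum>k=0..p. (norm (traj A \<phi> x k))\<^sup>2)"

definition region :: "(real^'n \<Rightarrow> real^'n) \<Rightarrow> (real^'n \<Rightarrow> real^'n) \<Rightarrow> real \<Rightarrow> nat \<Rightarrow> (real^'n) set" where
  "region A \<phi> r p = {x. V A \<phi> p x < (real p + 1) * r\<^sup>2}"

(* Multi-indices alpha with |alpha| <= q; they parametrise the monomials of degree at most q. *)
definition exponents :: "nat \<Rightarrow> ('n::finite \<Rightarrow> nat) set" where
  "exponents q = {\<alpha>. (\<Sum>i\<in>UNIV. \<alpha> i) \<le> q}"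

(* The finite type 'm plays the role of the index set {1..n_q}.  The ordering of the monomials
   is an arbitrary enumeration, i.e. a bijection mon from 'm onto exponents q (which forces
   CARD('m) to be the number n_q of monomials); with such a mon, monomials mon y is Z_q{y}. *)
definition monomials :: "('m \<Rightarrow> 'n \<Rightarrow> nat) \<Rightarrow> real^'n \<Rightarrow> real^'m" where
  "monomials mon y = (\<chi> a. \<Prod>i\<in>UNIV. (y $ i) ^ mon a i)"

definition quad :: "real^'m^'m \<Rightarrow> real^'m \<Rightarrow> real" where
  "quad \<Theta> z = z \<bullet> (\<Theta> *v z)"

definition psd :: "(real^'m^'m) set" where
  "psd = {\<Theta>. transpose \<Theta> = \<Theta> \<and> (\<forall>v. 0 \<le> v \<bullet> (\<Theta> *v v))}"

(* The largest gamma is taken among the extended reals, where it exists for every eps >= 0.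
   For 0 < eps < 1 it is real (lemma prob_inf_real); for eps >= 1 every real gamma
   is admissible, and the value is infinity. *)
definition prob_inf :: "'w measure \<Rightarrow> real \<Rightarrow> ('w \<Rightarrow> real) \<Rightarrow> ereal" where
  "prob_inf M \<epsilon> f = (GREATEST \<gamma>. measure M {\<omega> \<in> space M. \<gamma> \<le> ereal (f \<omega>)} \<ge> 1 - \<epsilon>)"

lemma (in prob_space) prob_inf_greatest:
  assumes [measurable]: "f \<in> borel_measurable M" and "0 \<le> \<epsilon>"
  shows "prob {\<omega> \<in> space M. prob_inf M \<epsilon> f \<le> ereal (f \<omega>)} \<ge> 1 - \<epsilon>"
    and "\<And>\<gamma>. prob {\<omega> \<in> space M. \<gamma> \<le> ereal (f \<omega>)} \<ge> 1 - \<epsilon> \<Longrightarrow> \<gamma> \<le> prob_inf M \<epsilon> f"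
proof -
  let ?P = "\<lambda>\<gamma>::ereal. prob {\<omega> \<in> space M. \<gamma> \<le> ereal (f \<omega>)} \<ge> 1 - \<epsilon>"
  have "?P (-\<infinity>)" using assms(2) by (simp add: prob_space)
  then have "{\<gamma>. ?P \<gamma>} \<noteq> {}" by blast
  from Sup_countable_SUP[OF this] obtain g where
    g: "incseq g" "range g \<subseteq> {\<gamma>. ?P \<gamma>}" "Sup {\<gamma>. ?P \<gamma>} = (SUP i. g i)" by blast
  define s where "s = Sup {\<gamma>. ?P \<gamma>}"
  have eq: "(\<Inter>i::nat. {\<omega> \<in> space M. g i \<le> ereal (f \<omega>)}) = {\<omega> \<in> space M. s \<le> ereal (f \<omega>)}"
    unfolding s_def g(3) by (auto simp: SUP_le_iff)
  have "(\<lambda>i. prob {\<omega> \<in> space M. g i \<le> ereal (f \<omega>)}) \<longlonglongrightarrow> prob {\<omega> \<in> space M. s \<le> ereal (f \<omega>)}"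
    unfolding eq[symmetric]
  proof (rule finite_Lim_measure_decseq)
    show "range (\<lambda>i. {\<omega> \<in> space M. g i \<le> ereal (f \<omega>)}) \<subseteq> events" by auto
    show "decseq (\<lambda>i. {\<omega> \<in> space M. g i \<le> ereal (f \<omega>)})"
      using g(1) by (auto simp: decseq_def incseq_def intro: order_trans)
  qed
  then have Ps: "?P s" by (rule LIMSEQ_le_const) (use g(2) in auto)
  have ub: "\<And>\<gamma>. ?P \<gamma> \<Longrightarrow> \<gamma> \<le> s" unfolding s_def by (auto intro: Sup_upper)
  have "prob_inf M \<epsilon> f = s" unfolding prob_inf_def by (rule Greatest_equality) (use Ps ub in auto)
  with Ps ub show "?P (prob_inf M \<epsilon> f)" "\<And>\<gamma>. ?P \<gamma> \<Longrightarrow> \<gamma> \<le> prob_inf M \<epsilon> f" by auto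
qed

lemma (in prob_space) prob_inf_real:
  assumes [measurable]: "f \<in> borel_measurable M" and "0 < \<epsilon>" "\<epsilon> < 1"
  shows "prob_inf M \<epsilon> f = ereal (GREATEST \<gamma>. prob {\<omega> \<in> space M. \<gamma> \<le> f \<omega>} \<ge> 1 - \<epsilon>)"
proof -
  have ge: "prob {\<omega> \<in> space M. prob_inf M \<epsilon> f \<le> ereal (f \<omega>)} \<ge> 1 - \<epsilon>"
    and ub: "\<And>\<gamma>. prob {\<omega> \<in> space M. \<gamma> \<le> ereal (f \<omega>)} \<ge> 1 - \<epsilon> \<Longrightarrow> \<gamma> \<le> prob_inf M \<epsilon> f"
    using prob_inf_greatest[OF assms(1), of \<epsilon>] assms(2) by auto
  have "prob_inf M \<epsilon> f \<noteq> \<infinity>" using ge assms(3) by auto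
  moreover have "prob_inf M \<epsilon> f \<noteq> -\<infinity>"
  proof -
    have eq: "(\<Union>i::nat. {\<omega> \<in> space M. - real i \<le> f \<omega>}) = space M"
    proof (intro equalityI subsetI)
      fix \<omega> assume "\<omega> \<in> space M"
      moreover obtain i :: nat where "- f \<omega> \<le> real i" using real_arch_simple by blast
      ultimately show "\<omega> \<in> (\<Union>i::nat. {\<omega> \<in> space M. - real i \<le> f \<omega>})"
        by (auto intro!: exI[of _ i])
    qed auto
    have "(\<lambda>i. prob {\<omega> \<in> space M. - real i \<le> f \<omega>})
            \<longlonglongrightarrow> prob (\<Union>i::nat. {\<omega> \<in> space M. - real i \<le> f \<omega>})"
      by (rule finite_Lim_measure_incseq) (auto simp: incseq_def)
    then have "(\<lambda>i. prob {\<omega> \<in> space M. - real i \<le> f \<omega>}) \<longlonglongrightarrow> 1"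
      by (simp only: eq prob_space)
    then have "\<forall>\<^sub>F i in sequentially. 1 - \<epsilon> < prob {\<omega> \<in> space M. - real i \<le> f \<omega>}"
      by (rule order_tendstoD) (use assms(2) in simp)
    then obtain i where "1 - \<epsilon> < prob {\<omega> \<in> space M. - real i \<le> f \<omega>}"
      by (auto simp: eventually_sequentially)
    then have "ereal (- real i) \<le> prob_inf M \<epsilon> f" by (intro ub) simp
    then show ?thesis by auto
  qed
  ultimately obtain s where s: "prob_inf M \<epsilon> f = ereal s" by (cases "prob_inf M \<epsilon> f") auto
  have "(GREATEST \<gamma>. prob {\<omega> \<in> space M. \<gamma> \<le> f \<omega>} \<ge> 1 - \<epsilon>) = s"
  proof (rule Greatest_equality)
    show "prob {\<omega> \<in> space M. s \<le> f \<omega>} \<ge> 1 - \<epsilon>" using ge s by simp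
  next
    fix \<gamma> assume "prob {\<omega> \<in> space M. \<gamma> \<le> f \<omega>} \<ge> 1 - \<epsilon>"
    then show "\<gamma> \<le> s" using ub[of "ereal \<gamma>"] s by simp
  qed
  with s show ?thesis by simp
qed

end

theory Submission
  imports Defs
begin

text \<open>
  Write \<open>f\<close> for the real random variable under study and \<open>\<gamma>\<close> for its probabilistic infimum. As
  \<open>\<gamma>\<close> is the largest level that \<open>f\<close> reaches with probability at least \<open>1 - \<epsilon>\<close>, every level above
  it is reached with probability below \<open>1 - \<epsilon>\<close>; for \<open>\<gamma> < \<infinity>\<close>, letting the level decrease to \<open>\<gamma>\<close> gives
  \<open>P(f > \<gamma>) \<le> 1 - \<epsilon> \<le> exp (- \<epsilon>)\<close>, the lemma \<open>prob_greater_prob_inf_le\<close>. The minimum over \<open>N\<close>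
  samples exceeds \<open>\<gamma>\<close> only if every single sample does, and by independence this has probability
  at most \<open>exp (- \<epsilon> N)\<close>. Because \<open>e / (e - 1) > 1\<close>, the condition on the sample size makes this
  number smaller than \<open>\<delta>\<close> if \<open>\<delta> < 1\<close>; otherwise it suffices that it is below \<open>1\<close>.

  The quadratic form in the monomials enters only as a Borel function of the state, so the
  estimate is an instance of the general bound \<open>prob_inf_less_sample_Min_le\<close>.
\<close>

text \<open>
  The bound \<open>exp (- \<epsilon>)\<close> in place of \<open>1 - \<epsilon>\<close> covers \<open>\<epsilon> > 1\<close> as well: there the infimum is
  \<open>\<infinity>\<close> and the event is empty, but \<open>1 - \<epsilon>\<close> is negative.
\<close>
lemma (in prob_space) prob_greater_prob_inf_le:
  assumes f [measurable]: "f \<in> borel_measurable M" and eps: "0 \<le> \<epsilon>"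
  shows "prob {\<omega> \<in> space M. prob_inf M \<epsilon> f < ereal (f \<omega>)} \<le> exp (- \<epsilon>)"
proof (cases "prob_inf M \<epsilon> f = \<infinity>")
  case True
  then show ?thesis by simp
next
  case False
  define \<gamma> where "\<gamma> = prob_inf M \<epsilon> f"
  have above_nonempty: "{\<gamma><..} \<noteq> {}"
    using False greaterThan_iff[of \<infinity> \<gamma>] by (force simp: \<gamma>_def simp del: greaterThan_iff)
  \<comment> \<open>Levels \<open>g i\<close> decreasing to \<open>\<gamma>\<close> from strictly above: the events \<open>g i \<le> f\<close> then increase to
    \<open>\<gamma> < f\<close>, and each is too improbable for its level to be admissible.\<close>
  from Inf_countable_INF[OF this] obtain g where
    g: "decseq g" "range g \<subseteq> {\<gamma><..}" "Inf {\<gamma><..} = (INF i. g i)" by blast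
  have "{\<gamma><..} = {\<gamma><..\<infinity>}" by auto
  then have inf_above: "Inf {\<gamma><..} = \<gamma>"
    using False cInf_greaterThanAtMost[of \<gamma> \<infinity>] by (simp add: \<gamma>_def)
  have inf_g: "(INF i. g i) = \<gamma>" by (rule trans[OF g(3)[symmetric] inf_above])
  have union_eq: "(\<Union>i::nat. {\<omega> \<in> space M. g i \<le> ereal (f \<omega>)}) = {\<omega> \<in> space M. \<gamma> < ereal (f \<omega>)}"
    (is "?L = ?R")
  proof (intro equalityI subsetI)
    fix \<omega> assume "\<omega> \<in> ?L"
    then obtain i where \<omega>: "\<omega> \<in> space M" and le: "g i \<le> ereal (f \<omega>)" by blast
    have "\<gamma> < g i" using g(2) by auto
    also note le
    finally show "\<omega> \<in> ?R" using \<omega> by simp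
  next
    fix \<omega> assume \<omega>: "\<omega> \<in> ?R"
    then have "(INF i. g i) < ereal (f \<omega>)" by (simp add: inf_g)
    then obtain i where "g i < ereal (f \<omega>)" by (auto simp: INF_less_iff)
    with \<omega> show "\<omega> \<in> ?L" by (auto intro: less_imp_le)
  qed
  have lim: "(\<lambda>i. prob {\<omega> \<in> space M. g i \<le> ereal (f \<omega>)}) \<longlonglongrightarrow> prob {\<omega> \<in> space M. \<gamma> < ereal (f \<omega>)}"
    unfolding union_eq[symmetric]
  proof (rule finite_Lim_measure_incseq)
    show "range (\<lambda>i. {\<omega> \<in> space M. g i \<le> ereal (f \<omega>)}) \<subseteq> events" by auto
    show "incseq (\<lambda>i. {\<omega> \<in> space M. g i \<le> ereal (f \<omega>)})"
      using g(1) by (auto simp: decseq_def incseq_def intro: order_trans)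
  qed
  have "prob {\<omega> \<in> space M. g i \<le> ereal (f \<omega>)} \<le> 1 - \<epsilon>" for i
  proof -
    have "\<gamma> < g i" using g(2) by auto
    with prob_inf_greatest(2)[OF f eps, of "g i"] show ?thesis
      by (force simp: \<gamma>_def)
  qed
  with lim have "prob {\<omega> \<in> space M. \<gamma> < ereal (f \<omega>)} \<le> 1 - \<epsilon>"
    by (auto intro: LIMSEQ_le_const2)
  also have "\<dots> \<le> exp (- \<epsilon>)" using exp_ge_add_one_self[of "- \<epsilon>"] by simp
  finally show ?thesis by (simp add: \<gamma>_def)
qed

lemma (in prob_space) prob_iid_samples_all_in:
  assumes X: "X \<in> measurable M N"
    and indep: "indep_vars (\<lambda>_. N) Y J"
    and distr: "\<And>j. j \<in> J \<Longrightarrow> distr M N (Y j) = distr M N X"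
    and J: "finite J" "J \<noteq> {}"
    and B: "B \<in> sets N"
  shows "prob {\<omega> \<in> space M. \<forall>j\<in>J. Y j \<omega> \<in> B} = prob {\<omega> \<in> space M. X \<omega> \<in> B} ^ card J"
proof -
  have rv: "Y j \<in> measurable M N" if "j \<in> J" for j
    using indep that by (auto simp: indep_vars_def)
  have same: "prob (Y j -` B \<inter> space M) = prob (X -` B \<inter> space M)" if "j \<in> J" for j
    using measure_distr[OF rv[OF that] B] measure_distr[OF X B] distr[OF that] by simp
  have "{\<omega> \<in> space M. \<forall>j\<in>J. Y j \<omega> \<in> B} = (\<Inter>j\<in>J. Y j -` B \<inter> space M)"
    using J(2) by auto
  also have "prob \<dots> = (\<Prod>j\<in>J. prob (Y j -` B \<inter> space M))"
    using indep_varsD[OF indep J(2,1) subset_refl] B by simp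
  also have "\<dots> = prob (X -` B \<inter> space M) ^ card J"
    using same by simp
  also have "X -` B \<inter> space M = {\<omega> \<in> space M. X \<omega> \<in> B}" by auto
  finally show ?thesis .
qed

text \<open>
  If the minimum exceeds the infimum then so does the value at each sample, so \<open>card J\<close>
  independent copies of the event in \<open>prob_greater_prob_inf_le\<close> occur together.
\<close>
lemma (in prob_space) prob_inf_less_sample_Min_le:
  assumes X [measurable]: "X \<in> measurable M N"
    and h [measurable]: "h \<in> borel_measurable N"
    and indep: "indep_vars (\<lambda>_. N) Y J"
    and distr: "\<And>j. j \<in> J \<Longrightarrow> distr M N (Y j) = distr M N X"
    and J: "finite J" "J \<noteq> {}"
    and eps: "0 \<le> \<epsilon>"
  shows "prob {\<omega> \<in> space M. prob_inf M \<epsilon> (\<lambda>\<omega>'. h (X \<omega>')) < ereal (MIN j\<in>J. h (Y j \<omega>))}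
           \<le> exp (- (\<epsilon> * real (card J)))"
proof -
  define \<gamma> where "\<gamma> = prob_inf M \<epsilon> (\<lambda>\<omega>'. h (X \<omega>'))"
  define B where "B = {x \<in> space N. \<gamma> < ereal (h x)}"
  have B [measurable]: "B \<in> sets N" unfolding B_def by measurable
  have rv [measurable]: "Y j \<in> measurable M N" if "j \<in> J" for j
    using indep that by (auto simp: indep_vars_def)
  have "{\<omega> \<in> space M. \<gamma> < ereal (MIN j\<in>J. h (Y j \<omega>))} \<subseteq> {\<omega> \<in> space M. \<forall>j\<in>J. Y j \<omega> \<in> B}"
  proof clarify
    fix \<omega> j assume \<omega>: "\<omega> \<in> space M" and less: "\<gamma> < ereal (MIN j\<in>J. h (Y j \<omega>))" and j: "j \<in> J"
    have "(MIN j\<in>J. h (Y j \<omega>)) \<le> h (Y j \<omega>)" using J j by simp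
    with less have "\<gamma> < ereal (h (Y j \<omega>))" by (meson ereal_less_eq(3) less_le_trans)
    with \<omega> rv[OF j] show "Y j \<omega> \<in> B" by (auto simp: B_def dest: measurable_space)
  qed
  moreover have "{\<omega> \<in> space M. \<forall>j\<in>J. Y j \<omega> \<in> B} \<in> events"
    using J by measurable
  ultimately have "prob {\<omega> \<in> space M. \<gamma> < ereal (MIN j\<in>J. h (Y j \<omega>))}
      \<le> prob {\<omega> \<in> space M. \<forall>j\<in>J. Y j \<omega> \<in> B}"
    by (rule finite_measure_mono)
  also have "\<dots> = prob {\<omega> \<in> space M. X \<omega> \<in> B} ^ card J"
    by (rule prob_iid_samples_all_in[OF X indep distr J B])
  also have "{\<omega> \<in> space M. X \<omega> \<in> B} = {\<omega> \<in> space M. \<gamma> < ereal (h (X \<omega>))}"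
    using measurable_space[OF X] by (auto simp: B_def)
  also have "prob \<dots> ^ card J \<le> exp (- \<epsilon>) ^ card J"
    unfolding \<gamma>_def using eps by (intro power_mono prob_greater_prob_inf_le) auto
  also have "\<dots> = exp (- (\<epsilon> * real (card J)))"
    by (simp add: exp_of_nat_mult[symmetric] mult.commute)
  finally show ?thesis by (simp add: \<gamma>_def)
qed

text \<open>
  For \<open>\<delta> < 1\<close> the bound is strict because the logarithm is positive and \<open>e / (e - 1) > 1\<close>; for
  \<open>\<delta> \<ge> 1\<close> it is \<open>t > 0\<close> that gives \<open>exp (- t) < 1 \<le> \<delta>\<close>.
\<close>
lemma exp_minus_less_of_sample_bound:
  fixes t \<delta> :: real
  assumes "0 < t" "0 < \<delta>" and bound: "exp 1 / (exp 1 - 1) * ln (inverse \<delta>) \<le> t"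
  shows "exp (- t) < \<delta>"
proof -
  have "ln (inverse \<delta>) < t"
  proof (cases "\<delta> < 1")
    case True
    then have pos: "0 < ln (inverse \<delta>)" using assms(2) by (simp add: ln_inverse)
    have "(1::real) < exp 1" by simp
    then have "1 < exp 1 / (exp 1 - (1::real))" by (simp add: field_simps)
    from mult_strict_right_mono[OF this pos] bound show ?thesis by simp
  next
    case False
    then have "0 \<le> ln \<delta>" by simp
    then have "ln (inverse \<delta>) \<le> 0" using assms(2) by (simp add: ln_inverse)
    with assms(1) show ?thesis by linarith
  qed
  then have "- t < ln \<delta>" using assms(2) by (simp add: ln_inverse)
  then show ?thesis using assms(2) by (metis exp_less_mono exp_ln)
qed

lemma borel_measurable_quad_monomials:
  "(\<lambda>y. quad \<Theta> (monomials mon y)) \<in> borel_measurable borel"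
  unfolding quad_def monomials_def
  by (intro borel_measurable_continuous_onI continuous_intros
      bounded_linear.continuous_on[OF matrix_vector_mul_bounded_linear])

theorem lemma3:
  fixes A \<phi> :: "real^'n \<Rightarrow> real^'n"
    and pt p q N\<^sub>2 :: nat
    and rt \<epsilon> \<delta> :: real
    and D :: "(real^'n) set"
    and mon :: "'m::finite \<Rightarrow> 'n \<Rightarrow> nat"
    and M :: "'w measure"
    and xbar :: "'w \<Rightarrow> real^'n"
    and xs :: "nat \<Rightarrow> 'w \<Rightarrow> real^'n"
    and \<Theta> :: "real^'m^'m"
  assumes lin: "linear A"
    and lip: "\<exists>L. L-lipschitz_on UNIV \<phi>"
    and phi0: "\<phi> 0 = 0"
    and stable: "origin_loc_asymp_stable A \<phi>"
    and rt_pos: "rt > 0"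
    and contr: "\<forall>x. 0 < norm x \<and> norm x < rt \<longrightarrow>
                  (\<forall>j\<in>{pt..<2*pt}. norm (traj A \<phi> x j) < norm x)"
    and p_ge: "p \<ge> pt"
    and D_compact: "compact D"
    and D_sup: "region A \<phi> rt p \<subset> D"
    and prob_M: "prob_space M"
    and xbar_rv: "xbar \<in> measurable M borel"
    and xbar_val: "\<forall>\<omega>\<in>space M. xbar \<omega> \<in> D - region A \<phi> rt p"
    and xs_indep: "prob_space.indep_vars M (\<lambda>_. borel) xs {1..N\<^sub>2}"
    and xs_distr: "\<forall>j\<in>{1..N\<^sub>2}. distr M borel (xs j) = distr M borel xbar"
    and mon_enum: "bij_betw mon UNIV (exponents q)"
    and eps_pos: "\<epsilon> > 0"
    and delta_pos: "\<delta> > 0"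
    and N2_pos: "N\<^sub>2 \<ge> 1"
    and N2_bound: "\<epsilon> * real N\<^sub>2 \<ge> exp 1 / (exp 1 - 1) * ln (inverse \<delta>)"
    and Theta_psd: "\<Theta> \<in> psd"
  shows "measure M {\<omega> \<in> space M.
           prob_inf M \<epsilon> (\<lambda>\<omega>'. quad \<Theta> (monomials mon (xbar \<omega>')))
             < ereal (MIN j\<in>{1..N\<^sub>2}. quad \<Theta> (monomials mon (xs j \<omega>)))} < \<delta>"
proof -
  interpret prob_space M by (rule prob_M)
  have "prob {\<omega> \<in> space M.
           prob_inf M \<epsilon> (\<lambda>\<omega>'. quad \<Theta> (monomials mon (xbar \<omega>')))
             < ereal (MIN j\<in>{1..N\<^sub>2}. quad \<Theta> (monomials mon (xs j \<omega>)))}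
         \<le> exp (- (\<epsilon> * real (card {1..N\<^sub>2})))"
    using xs_distr N2_pos eps_pos
    by (intro prob_inf_less_sample_Min_le[OF xbar_rv borel_measurable_quad_monomials xs_indep]) auto
  also have "\<dots> < \<delta>"
    using exp_minus_less_of_sample_bound[OF _ delta_pos N2_bound] eps_pos N2_pos by simp
  finally show ?thesis .
qed

end
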